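(* Let $G$ be a circular-arc graph. If $G$ is connected, then $\operatorname{lpt}(G)\leq 3$, and if $G$ is $2$-connected, then $\operatorname{lct}(G)\leq 3$.
   Context: All graphs are simple, finite, and undirected; the order of a path is its number of vertices. A circular-arc graph is a graph that is the intersection graph of a (finite) collection $\mathcal{F}$ of open arcs of a circle: its vertices correspond to the arcs in $\mathcal{F}$, and two distinct vertices are adjacent if and only if the corresponding arcs have non-empty intersection. A longest path (longest cycle) of $G$ is a path (cycle) in $G$ of maximum order among all paths (cycles) in $G$. A longest path transversal (longest cycle transversal) of $G$ is a set of vertices of $G$ that intersects the vertex set of every longest path (every longest cycle) of $G$. $\operatorname{lpt}(G)$ denotes the minimum cardinality of a longest path transversal of $G$, and $\operatorname{lct}(G)$ denotes the minimum cardinality of a longest cycle transversal of $G$. As usual, a graph is $2$-connected if it has at least $3$ vertices, is connected, and remains connected after the deletion of any single vertex. *)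

theory Defs
  imports Complex_Main "Graph_Theory.Graph_Theory"
begin

text \<open>
  A finite simple undirected graph is a \<open>graph\<close> in the sense of \<open>Graph_Theory\<close>: a finite, symmetric,
  loop-free digraph without parallel arcs, in which an edge is a pair of opposite arcs and
  adjacency is \<open>u \<rightarrow>\<^bsub>G\<^esub> v\<close>. The name \<open>connected\<close> is always qualified, because it is also
  the name of the topological notion.
\<close>


section \<open>Circular-arc graphs\<close>

text \<open>
  The circle is the unit circle of the complex plane. The bound \<open>b \<le> a + 2 * pi\<close> makes \<open>cis\<close>
  injective on the interval; equality gives the circle without one point.
\<close>

definition open_arc :: "complex set \<Rightarrow> bool" where
  "open_arc A \<longleftrightarrow> (\<exists>a b :: real. a < b \<and> b \<le> a + 2 * pi \<and> A = cis ` {a<..<b})"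

text \<open>
  The collection of arcs is the family \<open>(F v)\<close> indexed by the vertices; distinct vertices may
  have the same arc.
\<close>

definition circular_arc_graph :: "('a, 'b) pre_digraph \<Rightarrow> bool" where
  "circular_arc_graph G \<longleftrightarrow> graph G \<and>
     (\<exists>F. (\<forall>v\<in>verts G. open_arc (F v)) \<and>
          (\<forall>u\<in>verts G. \<forall>v\<in>verts G. u \<noteq> v \<longrightarrow> (u \<rightarrow>\<^bsub>G\<^esub> v \<longleftrightarrow> F u \<inter> F v \<noteq> {})))"


section \<open>2-connected graphs\<close>

definition two_connected :: "('a, 'b) pre_digraph \<Rightarrow> bool" where
  "two_connected G \<longleftrightarrow> card (verts G) \<ge> 3 \<and> Digraph_Component.connected G \<and>
     (\<forall>v\<in>verts G. Digraph_Component.connected (pre_digraph.del_vert G v))"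


section \<open>Longest paths and longest path transversals\<close>

text \<open>
  A path is a \<open>vpath\<close>, a nonempty list of distinct vertices, so its order is the length of the list.
\<close>

definition longest_path :: "('a, 'b) pre_digraph \<Rightarrow> 'a list \<Rightarrow> bool" where
  "longest_path G p \<longleftrightarrow> vpath p G \<and> (\<forall>q. vpath q G \<longrightarrow> length q \<le> length p)"

definition longest_path_transversal :: "('a, 'b) pre_digraph \<Rightarrow> 'a set \<Rightarrow> bool" where
  "longest_path_transversal G S \<longleftrightarrow>
     S \<subseteq> verts G \<and> (\<forall>p. longest_path G p \<longrightarrow> S \<inter> set p \<noteq> {})"

definition lpt :: "('a, 'b) pre_digraph \<Rightarrow> nat" where
  "lpt G = (LEAST k. \<exists>S. longest_path_transversal G S \<and> card S = k)"


section \<open>Longest cycles and longest cycle transversals\<close>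

text \<open>
  A cycle is given by the list of its vertices, each listed once. Without the condition on the
  length, a single edge \<open>[u, v]\<close> would count, as it does for \<open>pre_digraph.cycle\<close>.
\<close>

definition vcycle :: "'a list \<Rightarrow> ('a, 'b) pre_digraph \<Rightarrow> bool" where
  "vcycle c G \<longleftrightarrow> vpath c G \<and> length c \<ge> 3 \<and> last c \<rightarrow>\<^bsub>G\<^esub> hd c"

definition longest_cycle :: "('a, 'b) pre_digraph \<Rightarrow> 'a list \<Rightarrow> bool" where
  "longest_cycle G c \<longleftrightarrow> vcycle c G \<and> (\<forall>d. vcycle d G \<longrightarrow> length d \<le> length c)"

definition longest_cycle_transversal :: "('a, 'b) pre_digraph \<Rightarrow> 'a set \<Rightarrow> bool" where
  "longest_cycle_transversal G S \<longleftrightarrow>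
     S \<subseteq> verts G \<and> (\<forall>c. longest_cycle G c \<longrightarrow> S \<inter> set c \<noteq> {})"

definition lct :: "('a, 'b) pre_digraph \<Rightarrow> nat" where
  "lct G = (LEAST k. \<exists>S. longest_cycle_transversal G S \<and> card S = k)"


text \<open>The whole vertex set is a transversal, so both minima are attained.\<close>

lemma longest_path_transversal_verts: "longest_path_transversal G (verts G)"
  by (auto simp: longest_path_transversal_def longest_path_def vpath_def vwalk_def)
     (metis Int_absorb1 set_empty)

lemma longest_cycle_transversal_verts: "longest_cycle_transversal G (verts G)"
  by (auto simp: longest_cycle_transversal_def longest_cycle_def vcycle_def vpath_def vwalk_def)
     (metis Int_absorb1 set_empty)

lemma lpt_attained: "\<exists>S. longest_path_transversal G S \<and> card S = lpt G"
  unfolding lpt_def by (rule LeastI_ex) (use longest_path_transversal_verts in blast)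

lemma lct_attained: "\<exists>S. longest_cycle_transversal G S \<and> card S = lct G"
  unfolding lct_def by (rule LeastI_ex) (use longest_cycle_transversal_verts in blast)

end

theory Submission
  imports Defs
begin

text \<open>
  Both bounds hold with 2 in place of 3, and one argument serves for paths and cycles. The only
  feature of a longest path or cycle that enters is that no outside vertex \<open>v\<close> can be inserted
  between two consecutive vertices \<open>x\<close>, \<open>y\<close>; such a list is called \<open>saturated\<close> below. As any point
  of \<open>F x \<inter> F y \<inter> F v\<close> would make \<open>v\<close> adjacent to both, the overlap of \<open>x\<close> and \<open>y\<close> avoids the arc of
  every vertex that the list misses. If \<open>F x \<subseteq> F v\<close>, the overlap lies in \<open>F v\<close>; hence a saturated list
  contains, with \<open>x\<close>, every vertex whose arc includes that of \<open>x\<close> (\<open>saturated_upward_closed\<close>).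
  It follows that two saturated lists that meet share a vertex whose arc is maximal under inclusion,
  so only the maximal arcs matter.

  Suppose that a saturated list misses two maximal arcs \<open>k\<close> and \<open>h\<close>. All its overlaps lie in the
  complement of \<open>F k \<union> F h\<close>, which has at most one part on each side of \<open>h\<close> once the circle is cut at
  \<open>k\<close>. An arc of the list that has points in both parts would include \<open>F k\<close> or \<open>F h\<close>, hence be equal
  to it by maximality, and upward closure would put \<open>k\<close> or \<open>h\<close> into the list. Since consecutive
  overlaps lie in a common arc, all overlaps are in the same part (\<open>saturated_one_side\<close>). Hence, in the order of left endpoints around the circle, starting at \<open>k\<close>, the
  maximal arcs in a saturated list that misses \<open>k\<close> form an interval. Any two of these intervals
  intersect, so one maximal arc \<open>h\<close> is in all of them: the last arc of the interval that ends
  first. Then \<open>{k, h}\<close> is a transversal (\<open>saturated_transversal\<close>).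

  The hypotheses on connectivity guarantee that the lists pairwise meet. Two disjoint longest paths
  of a connected graph could be joined by a path, and the longer halves at its ends would make a
  longer path. Two disjoint longest cycles of a 2-connected graph could be joined by two disjoint
  paths (\<open>two_disjoint_vpaths\<close>, the case of Menger's theorem that is needed), and the longer halves
  of the two cycles would make a longer cycle.
\<close>


section \<open>Vertex paths\<close>

lemma vpath_iff:
  "vpath p G \<longleftrightarrow> p \<noteq> [] \<and> distinct p \<and> set p \<subseteq> verts G \<and> successively (dominates G) p"
proof -
  have "set (vwalk_arcs p) \<subseteq> arcs_ends G \<longleftrightarrow> successively (dominates G) p"
    by (induction p rule: vwalk_arcs.induct) auto
  then show ?thesis unfolding vpath_def vwalk_def by auto
qed

context graph
begin

lemma adj_sym: "u \<rightarrow>\<^bsub>G\<^esub> v \<Longrightarrow> v \<rightarrow>\<^bsub>G\<^esub> u"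
  by (rule arcs_ends_symmetric[OF sym_arcs])

lemma vpath_rev: "vpath p G \<Longrightarrow> vpath (rev p) G"
  unfolding vpath_iff by (auto intro: successively_mono[OF _ adj_sym])

lemma vpath_append_iff:
  assumes "p \<noteq> []" "q \<noteq> []"
  shows "vpath (p @ q) G \<longleftrightarrow> vpath p G \<and> vpath q G \<and> set p \<inter> set q = {} \<and> last p \<rightarrow>\<^bsub>G\<^esub> hd q"
  using assms unfolding vpath_iff by (auto simp: successively_append_iff)

lemma vpath_prefix: "vpath (p @ q) G \<Longrightarrow> p \<noteq> [] \<Longrightarrow> vpath p G"
  by (cases "q = []") (auto simp: vpath_append_iff)

lemma vpath_suffix: "vpath (p @ q) G \<Longrightarrow> q \<noteq> [] \<Longrightarrow> vpath q G"
  by (cases "p = []") (auto simp: vpath_append_iff)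

lemma vpath_first_hit:
  assumes "vpath p G" "set p \<inter> X \<noteq> {}"
  obtains q where "vpath q G" "hd q = hd p" "last q \<in> X" "set (butlast q) \<inter> X = {}" "set q \<subseteq> set p"
proof -
  obtain ys x zs where "p = ys @ x # zs" "x \<in> X" "\<forall>y\<in>set ys. y \<notin> X"
    using split_list_first_prop[of p "\<lambda>x. x \<in> X"] assms(2) by blast
  with assms(1) show ?thesis
    using vpath_prefix[of "ys @ [x]" zs] that[of "ys @ [x]"] by (cases ys) auto
qed

text \<open>
  A path from \<open>A\<close> to \<open>B\<close> contains one that touches \<open>A\<close> and \<open>B\<close> in its ends alone: stop at the first
  vertex in \<open>B\<close>, then walk back from there to the first vertex in \<open>A\<close>.
\<close>

lemma vpath_trim:
  assumes "vpath p G" "hd p \<in> A" "last p \<in> B"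
  obtains q where "vpath q G" "hd q \<in> A" "last q \<in> B" "set q \<subseteq> set p"
    "set (tl q) \<inter> A = {}" "set (butlast q) \<inter> B = {}"
proof -
  have "p \<noteq> []" using assms(1) by (simp add: vpath_iff)
  then have "set p \<inter> B \<noteq> {}" using assms(3) last_in_set by blast
  from vpath_first_hit[OF assms(1) this] obtain r where r:
    "vpath r G" "hd r = hd p" "last r \<in> B" "set (butlast r) \<inter> B = {}" "set r \<subseteq> set p" by blast
  have "r \<noteq> []" using r(1) by (simp add: vpath_iff)
  then have "set (rev r) \<inter> A \<noteq> {}" using assms(2) r(2) hd_in_set[of r] by auto
  from vpath_first_hit[OF vpath_rev[OF r(1)] this] obtain q where q:
    "vpath q G" "hd q = last r" "last q \<in> A" "set (butlast q) \<inter> A = {}" "set q \<subseteq> set r"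
    using \<open>r \<noteq> []\<close> by (auto simp: hd_rev)
  have "q \<noteq> []" "distinct q" using q(1) by (simp_all add: vpath_iff)
  have "set (tl q) \<inter> B = {}"
  proof -
    have "set (tl q) \<subseteq> set r - {last r}"
      using q(2,5) \<open>q \<noteq> []\<close> \<open>distinct q\<close> by (cases q) auto
    also have "\<dots> \<subseteq> set (butlast r)"
      using \<open>r \<noteq> []\<close> by (cases r rule: rev_cases) auto
    finally show ?thesis using r(4) by blast
  qed
  with q r \<open>q \<noteq> []\<close> show ?thesis
    using that[of "rev q"] vpath_rev[OF q(1)]
    by (auto simp: hd_rev last_rev butlast_rev tl_rev)
qed

text \<open>
  The ends of the connecting path \<open>r\<close> belong to \<open>p\<close> and \<open>q\<close> already, so only its interior
  \<open>butlast (tl r)\<close> is inserted. The interior may be empty.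
\<close>

lemma vpath_join:
  assumes "vpath p G" "vpath r G" "vpath q G"
    and "last p = hd r" "last r = hd q"
    and "set (tl r) \<inter> set p = {}" "set (butlast r) \<inter> set q = {}" "set p \<inter> set q = {}"
  shows "vpath (p @ butlast (tl r) @ q) G"
proof -
  have ne: "p \<noteq> []" "q \<noteq> []" "r \<noteq> []" using assms unfolding vpath_iff by auto
  have "hd r \<noteq> last r"
    using assms(4,5,8) ne hd_in_set last_in_set by (metis IntI empty_iff)
  then obtain c m d where r: "r = c # m @ [d]"
    using ne(3) by (cases r; cases "tl r" rule: rev_cases) auto
  show ?thesis
  proof (cases "m = []")
    case True
    then have "c \<rightarrow>\<^bsub>G\<^esub> d" using assms(2) unfolding r by (simp add: vpath_iff)
    then show ?thesis using True assms ne unfolding r by (auto simp: vpath_append_iff)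
  next
    case False
    have "vpath ((c # m) @ [d]) G" using assms(2) r by simp
    then have "vpath ([c] @ m) G" "last m \<rightarrow>\<^bsub>G\<^esub> d"
      using False vpath_append_iff[of "c # m" "[d]"] by auto
    then have "vpath m G" "c \<rightarrow>\<^bsub>G\<^esub> hd m"
      using False vpath_append_iff[of "[c]" m] by auto
    then show ?thesis
      using assms ne False \<open>last m \<rightarrow>\<^bsub>G\<^esub> d\<close> unfolding r by (auto simp: vpath_append_iff)
  qed
qed

lemma vpath_insert:
  assumes "vpath p G" "Suc i < length p" "v \<in> verts G - set p" "p ! i \<rightarrow>\<^bsub>G\<^esub> v" "v \<rightarrow>\<^bsub>G\<^esub> p ! Suc i"
  shows "vpath (take (Suc i) p @ v # drop (Suc i) p) G"
proof -
  define xs ys where "xs = take (Suc i) p" and "ys = drop (Suc i) p"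
  have "p = xs @ ys" by (simp add: xs_def ys_def)
  moreover have "xs \<noteq> []" "ys \<noteq> []" "last xs = p ! i" "hd ys = p ! Suc i"
    using assms(2) by (auto simp: xs_def ys_def take_Suc_conv_app_nth hd_drop_conv_nth)
  ultimately have p: "p = xs @ ys" "xs \<noteq> []" "ys \<noteq> []" "last xs = p ! i" "hd ys = p ! Suc i" .
  then have "vpath xs G" "vpath ys G" "set xs \<inter> set ys = {}"
    using assms(1) vpath_append_iff[of xs ys] by auto
  then have "vpath (v # ys) G"
    using vpath_append_iff[of "[v]" ys] assms p by (auto simp: vpath_iff)
  then show ?thesis
    using vpath_append_iff[of xs "v # ys"] \<open>vpath xs G\<close> \<open>set xs \<inter> set ys = {}\<close> assms(3,4) p
    unfolding xs_def[symmetric] ys_def[symmetric] by auto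
qed


section \<open>Longest paths in a connected graph\<close>

lemma connected_vpath:
  assumes "Digraph_Component.connected G" "u \<in> verts G" "v \<in> verts G"
  obtains p where "vpath p G" "hd p = u" "last p = v"
proof -
  have "u \<rightarrow>\<^sup>*\<^bsub>G\<^esub> v"
    using symmetric_connected_imp_strongly_connected[OF sym_arcs assms(1)] assms(2,3) by auto
  then show ?thesis using that reachable_vpath_conv by blast
qed

lemma vpath_half:
  assumes "vpath p G" "c \<in> set p"
  obtains r where "vpath r G" "last r = c" "set r \<subseteq> set p" "length p < 2 * length r"
proof -
  obtain xs ys where p: "p = xs @ c # ys" using assms(2) by (meson split_list)
  have 1: "vpath (xs @ [c]) G" using assms(1) vpath_prefix[of "xs @ [c]" ys] by (simp add: p)
  have "vpath (c # ys) G" using assms(1) vpath_suffix[of xs "c # ys"] by (simp add: p)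
  from vpath_rev[OF this] have 2: "vpath (rev (c # ys)) G" .
  show ?thesis
    using that[OF 1] that[OF 2] by (cases "length ys \<le> length xs") (auto simp: p)
qed

text \<open>
  A path that links two disjoint longest paths, together with the longer half of each (the end of
  the link included), has more than \<open>n/2 + n/2\<close> vertices, where \<open>n\<close> is the maximum order.
\<close>

lemma longest_paths_meet:
  assumes con: "Digraph_Component.connected G" and "longest_path G p" "longest_path G q"
  shows "set p \<inter> set q \<noteq> {}"
proof
  assume disj: "set p \<inter> set q = {}"
  have p: "vpath p G" and q: "vpath q G" and len: "length q = length p"
    using assms by (auto simp: longest_path_def intro: antisym)
  have ne: "p \<noteq> []" "q \<noteq> []" using p q by (auto simp: vpath_iff)
  have "hd p \<in> verts G" "last q \<in> verts G"
    using p q ne hd_in_set[of p] last_in_set[of q] unfolding vpath_iff by blast+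
  from connected_vpath[OF con this] obtain r0 where
    r0: "vpath r0 G" "hd r0 = hd p" "last r0 = last q" .
  have "hd r0 \<in> set p" "last r0 \<in> set q" using r0(2,3) ne by simp_all
  from vpath_trim[OF r0(1) this] obtain r where
    r: "vpath r G" "hd r \<in> set p" "last r \<in> set q" "set r \<subseteq> set r0"
      "set (tl r) \<inter> set p = {}" "set (butlast r) \<inter> set q = {}" .
  obtain p' where p': "vpath p' G" "last p' = hd r" "set p' \<subseteq> set p" "length p < 2 * length p'"
    using vpath_half[OF p r(2)] .
  obtain q' where q': "vpath q' G" "last q' = last r" "set q' \<subseteq> set q" "length q < 2 * length q'"
    using vpath_half[OF q r(3)] .
  have ne': "q' \<noteq> []" using q'(1) by (simp add: vpath_iff)
  have "vpath (p' @ butlast (tl r) @ rev q') G"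
    using p' q' r disj ne' vpath_rev[OF q'(1)] by (intro vpath_join) (auto simp: hd_rev)
  moreover have "length p < length (p' @ butlast (tl r) @ rev q')"
    using p'(4) q'(4) len by auto
  ultimately show False using assms(2) by (auto simp: longest_path_def not_less[symmetric])
qed


section \<open>Longest cycles in a 2-connected graph\<close>

lemma two_connected_vpath:
  assumes "two_connected G" "w \<in> verts G" "u \<in> verts G - {w}" "v \<in> verts G - {w}"
  obtains p where "vpath p G" "hd p = u" "last p = v" "w \<notin> set p"
proof -
  let ?H = "del_vert w"
  interpret H: wf_digraph ?H by (rule wf_digraph_del_vert)
  have "symmetric ?H"
    using sym_arcs by (auto simp: symmetric_conv del_vert_simps)
  moreover have "Digraph_Component.connected ?H" using assms(1,2) by (simp add: two_connected_def)
  ultimately have "u \<rightarrow>\<^sup>*\<^bsub>?H\<^esub> v"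
    using H.symmetric_connected_imp_strongly_connected assms(3,4) by (auto simp: verts_del_vert)
  then obtain p where p: "vpath p ?H" "hd p = u" "last p = v"
    using H.reachable_vpath_conv by blast
  have "vpath p G" using p(1) subgraph_del_vert by (rule vpathI_subgraph)
  moreover have "w \<notin> set p" using p(1) by (auto simp: vpath_iff verts_del_vert)
  ultimately show ?thesis using that p by blast
qed

text \<open>
  This is meant for adjacent \<open>v\<close> and \<open>w\<close>. With both ends prescribed, the property can be carried along
  a walk from one edge to the next, and so from an edge of one cycle to an edge of another.
\<close>

definition linked :: "'a set \<Rightarrow> 'a \<Rightarrow> 'a \<Rightarrow> bool" where
  "linked A v w \<longleftrightarrow> (\<exists>p q. vpath p G \<and> vpath q G \<and> set p \<inter> set q = {} \<and>
     hd p \<in> A \<and> hd q \<in> A \<and> last p = v \<and> last q = w)"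

text \<open>
  Deleting \<open>w\<close> leaves a path from \<open>u\<close> to \<open>A\<close>. Follow it to the first vertex \<open>y\<close> in \<open>A\<close> or on one of the
  two given paths. If \<open>y\<close> is on the path \<open>p\<close> to \<open>v\<close>, or on neither path, then the reversed piece, after
  the part of \<open>p\<close> up to \<open>y\<close> if there is one, reaches \<open>u\<close> and avoids the path \<open>q\<close> to \<open>w\<close>. If \<open>y\<close> is
  on \<open>q\<close>, then \<open>u\<close> is reached through \<open>q\<close> up to \<open>y\<close>, and \<open>w\<close> through \<open>p\<close> and the edge from \<open>v\<close>
  to \<open>w\<close>.
\<close>

lemma linked_step:
  assumes con: "two_connected G" and A: "a \<in> A - {w}" "A \<subseteq> verts G"
    and vw: "linked A v w" "v \<rightarrow>\<^bsub>G\<^esub> w" and wu: "w \<rightarrow>\<^bsub>G\<^esub> u"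
  shows "linked A w u"
proof -
  obtain p q where p: "vpath p G" "hd p \<in> A" "last p = v" and q: "vpath q G" "hd q \<in> A" "last q = w"
    and disj: "set p \<inter> set q = {}"
    using vw(1) unfolding linked_def by blast
  have ne: "p \<noteq> []" "q \<noteq> []" and dist: "distinct q" using p q by (auto simp: vpath_iff)
  have wq: "w \<in> set q" using q ne by auto
  let ?X = "set p \<union> set q \<union> A"
  have "w \<in> verts G" "u \<in> verts G - {w}" "a \<in> verts G - {w}"
    using wu A adj_in_verts adj_not_same by blast+
  from two_connected_vpath[OF con this] obtain r0 where
    r0: "vpath r0 G" "hd r0 = u" "last r0 = a" "w \<notin> set r0" .
  have "a \<in> set r0" using r0 by (auto simp: vpath_iff)
  then have "set r0 \<inter> ?X \<noteq> {}" using A by blast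
  from vpath_first_hit[OF r0(1) this] obtain r' where r':
    "vpath r' G" "hd r' = hd r0" "last r' \<in> ?X" "set (butlast r') \<inter> ?X = {}" "set r' \<subseteq> set r0" .
  have "r' \<noteq> []" using r'(1) by (simp add: vpath_iff)
  then obtain m y where r'_eq: "r' = m @ [y]" by (metis append_butlast_last_id)
  define r where "r = rev m"
  have r: "vpath (y # r) G" "last (y # r) = u" "y \<in> ?X" "set r \<inter> ?X = {}" "w \<notin> set (y # r)"
    using r' r0 vpath_rev[OF r'(1)] unfolding r'_eq r_def by (cases m; auto simp: last_rev)+
  have extend: "vpath (xs @ y # r) G" "last (xs @ y # r) = u"
    if "vpath (xs @ y # zs) G" "set (xs @ y # zs) \<subseteq> ?X" for xs zs
  proof -
    show "last (xs @ y # r) = u" using r(2) by simp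
    show "vpath (xs @ y # r) G"
      using that r(1,4) vpath_append_iff[of xs "y # zs"] vpath_append_iff[of xs "y # r"]
      by (cases "xs = []") auto
  qed
  consider (P) "y \<in> set p" | (Q) "y \<in> set q" | (A) "y \<in> A" "y \<notin> set p" "y \<notin> set q"
    using r(3) by blast
  then show ?thesis
  proof cases
    case P
    then obtain xs zs where p_eq: "p = xs @ y # zs" by (meson split_list)
    have "vpath (xs @ y # r) G" "last (xs @ y # r) = u" using extend[of xs zs, folded p_eq] p(1) by blast+
    moreover have "hd (xs @ y # r) \<in> A" using p(2) p_eq by (cases xs) auto
    moreover have "set q \<inter> set (xs @ y # r) = {}" using disj r(4) p_eq by auto
    ultimately show ?thesis unfolding linked_def using q by blast
  next
    case Q
    then obtain xs zs where q_eq: "q = xs @ y # zs" by (meson split_list)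
    have "zs \<noteq> []" using r(5) q(3) q_eq by auto
    then have "w \<in> set zs" using q(3) q_eq by auto
    have "vpath (xs @ y # r) G" "last (xs @ y # r) = u" using extend[of xs zs, folded q_eq] q(1) by blast+
    moreover have "hd (xs @ y # r) \<in> A" using q(2) q_eq by (cases xs) auto
    moreover have "vpath (p @ [w]) G"
      using vpath_append_iff[of p "[w]"] p q disj vw(2) wq ne \<open>w \<in> verts G\<close> by (auto simp: vpath_iff)
    moreover have "set (p @ [w]) \<inter> set (xs @ y # r) = {}"
      using disj r(4,5) dist \<open>w \<in> set zs\<close> unfolding q_eq by auto
    moreover have "hd (p @ [w]) \<in> A" "last (p @ [w]) = w" using p(2) ne by auto
    ultimately show ?thesis unfolding linked_def by blast
  next
    case A
    then have "set q \<inter> set (y # r) = {}" using r(4) by auto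
    then show ?thesis unfolding linked_def using q r(1,2) A(1) by (metis list.sel(1))
  qed
qed

lemma linked_along:
  assumes con: "two_connected G" and A: "a \<in> A" "a' \<in> A" "a \<noteq> a'" "A \<subseteq> verts G"
    and "successively (dominates G) (v # w # xs)" "linked A v w"
  shows "linked A (last (butlast (v # w # xs))) (last (w # xs))"
  using assms(6,7)
proof (induction xs arbitrary: v w)
  case Nil
  then show ?case by simp
next
  case (Cons u xs)
  obtain a'' where "a'' \<in> A - {w}" using A by (cases "a = w") auto
  from linked_step[OF con this A(4) Cons.prems(2)] have "linked A w u"
    using Cons.prems(1) by simp
  with Cons.IH[of w u] Cons.prems(1) show ?case by simp
qed

text \<open>
  The edge \<open>a' a\<close> inside \<open>A\<close> is linked by two one-vertex paths. A walk that begins with this edge and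
  ends with the edge \<open>b b'\<close> inside \<open>B\<close> carries the property \<open>linked\<close> to \<open>b\<close> and \<open>b'\<close>.
\<close>

lemma two_disjoint_vpaths:
  assumes con: "two_connected G"
    and A: "A \<subseteq> verts G" "a \<in> A" "a' \<in> A" "a' \<rightarrow>\<^bsub>G\<^esub> a"
    and B: "b \<in> B" "b' \<in> B" "b \<rightarrow>\<^bsub>G\<^esub> b'"
  obtains p q where "vpath p G" "vpath q G" "set p \<inter> set q = {}"
    "hd p \<in> A" "last p \<in> B" "set (tl p) \<inter> A = {}" "set (butlast p) \<inter> B = {}"
    "hd q \<in> A" "last q \<in> B" "set (tl q) \<inter> A = {}" "set (butlast q) \<inter> B = {}"
proof -
  have verts: "a \<in> verts G" "a' \<in> verts G" "b \<in> verts G" and "a \<noteq> a'"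
    using A B adj_in_verts adj_not_same by blast+
  have "Digraph_Component.connected G" using con by (simp add: two_connected_def)
  then obtain r where r: "vpath r G" "hd r = a" "last r = b"
    using connected_vpath verts by metis
  then obtain s where s: "r = a # s" unfolding vpath_iff by (metis list.collapse)
  have "vpath [a] G" "vpath [a'] G" using verts by (auto simp: vpath_iff)
  then have "linked A a' a"
    unfolding linked_def using A(2,3) \<open>a \<noteq> a'\<close>
    by (intro exI[of _ "[a']"] exI[of _ "[a]"]) auto
  moreover have "successively (dominates G) (a' # a # (s @ [b']))"
    using r(1,3) A(4) B(3) successively_append_iff[of "dominates G" "a # s" "[b']"]
    unfolding s vpath_iff by auto
  ultimately have "linked A (last (butlast (a' # a # (s @ [b'])))) (last (a # (s @ [b'])))"
    by (intro linked_along[OF con A(2,3) \<open>a \<noteq> a'\<close> A(1)])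
  moreover have "last (butlast (a' # a # (s @ [b']))) = b"
    using r(3) unfolding s by (simp add: butlast_append)
  ultimately have "linked A b b'" by simp
  then obtain p0 q0 where pq: "vpath p0 G" "vpath q0 G" "set p0 \<inter> set q0 = {}"
    "hd p0 \<in> A" "hd q0 \<in> A" "last p0 \<in> B" "last q0 \<in> B"
    using B(1,2) unfolding linked_def by blast
  obtain p where p: "vpath p G" "hd p \<in> A" "last p \<in> B" "set p \<subseteq> set p0"
    "set (tl p) \<inter> A = {}" "set (butlast p) \<inter> B = {}"
    using vpath_trim[OF pq(1,4,6)] .
  obtain q where q: "vpath q G" "hd q \<in> A" "last q \<in> B" "set q \<subseteq> set q0"
    "set (tl q) \<inter> A = {}" "set (butlast q) \<inter> B = {}"
    using vpath_trim[OF pq(2,5,7)] .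
  have "set p \<inter> set q = {}" using p(4) q(4) pq(3) by blast
  with p q that show ?thesis by blast
qed

text \<open>
  The two arcs of a cycle between \<open>x\<close> and \<open>y\<close> have \<open>length c + 2\<close> vertices together, since both contain
  \<open>x\<close> and \<open>y\<close>.
\<close>

lemma vcycle_half:
  assumes "vcycle c G" "x \<in> set c" "y \<in> set c" "x \<noteq> y"
  obtains r where "vpath r G" "hd r = x" "last r = y" "set r \<subseteq> set c" "length c + 2 \<le> 2 * length r"
proof -
  obtain us vs where c: "c = us @ x # vs" using assms(2) by (meson split_list)
  define d where "d = x # vs @ us"
  have d: "vpath d G" "last d \<rightarrow>\<^bsub>G\<^esub> x" "set d = set c" "length d = length c"
  proof -
    show "set d = set c" "length d = length c" by (auto simp: c d_def)
    have "vpath c G" "last c \<rightarrow>\<^bsub>G\<^esub> hd c" using assms(1) by (auto simp: vcycle_def)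
    then show "vpath d G" "last d \<rightarrow>\<^bsub>G\<^esub> x"
      using vpath_append_iff[of us "x # vs"] vpath_append_iff[of "x # vs" us]
      unfolding c d_def by (cases "us = []"; auto)+
  qed
  obtain ms ns where m: "d = (x # ms) @ y # ns"
  proof -
    have "y \<in> set (vs @ us)" using assms(3,4) by (auto simp: c)
    then obtain ms ns where "vs @ us = ms @ y # ns" by (meson split_list)
    then show ?thesis using that by (simp add: d_def)
  qed
  have 1: "vpath (x # ms @ [y]) G" using vpath_prefix[of "x # ms @ [y]" ns] d(1) m by simp
  have "vpath (y # ns) G" "x \<notin> set (y # ns)"
    using d(1) vpath_append_iff[of "x # ms" "y # ns"] unfolding m by auto
  moreover have "last (y # ns) \<rightarrow>\<^bsub>G\<^esub> x" using d(2) unfolding m by simp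
  moreover have "vpath [x] G" using adj_in_verts calculation(3) by (auto simp: vpath_iff)
  ultimately have "vpath ((y # ns) @ [x]) G" by (subst vpath_append_iff) auto
  from vpath_rev[OF this] have 2: "vpath (x # rev ns @ [y]) G" by simp
  have "set (x # ms @ [y]) \<subseteq> set c" "set (x # rev ns @ [y]) \<subseteq> set c"
    "length c = length ms + length ns + 2"
    using d(3,4) m by auto
  then show ?thesis
    using that[OF 1] that[OF 2] by (cases "length ns \<le> length ms") auto
qed

text \<open>
  Two disjoint paths between disjoint cycles of maximum order \<open>n\<close> would give a cycle made of these
  paths and of the longer arc of each cycle, hence of at least \<open>2 * (n/2 + 1)\<close> vertices.
\<close>

lemma longest_cycles_meet:
  assumes con: "two_connected G" and "longest_cycle G c" "longest_cycle G d"
  shows "set c \<inter> set d \<noteq> {}"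
proof
  assume disj: "set c \<inter> set d = {}"
  have c: "vcycle c G" and d: "vcycle d G" and len: "length d = length c"
    using assms by (auto simp: longest_cycle_def intro: antisym)
  have cv: "set c \<subseteq> verts G" and ne: "c \<noteq> []" "d \<noteq> []" and "length c \<ge> 3"
    using c d by (auto simp: vcycle_def vpath_iff)
  obtain p q where pq: "vpath p G" "vpath q G" "set p \<inter> set q = {}"
    and p: "hd p \<in> set c" "last p \<in> set d" "set (tl p) \<inter> set c = {}" "set (butlast p) \<inter> set d = {}"
    and q: "hd q \<in> set c" "last q \<in> set d" "set (tl q) \<inter> set c = {}" "set (butlast q) \<inter> set d = {}"
    by (rule two_disjoint_vpaths[OF con cv, of "hd c" "last c" "last d" "set d" "hd d"])
      (use c d ne in \<open>auto simp: vcycle_def\<close>)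
  have ne': "p \<noteq> []" "q \<noteq> []" using pq by (auto simp: vpath_iff)
  have ends: "hd p \<noteq> hd q" "last q \<noteq> last p"
    using pq(3) ne' hd_in_set last_in_set by (metis disjoint_iff)+
  obtain r where r: "vpath r G" "hd r = hd p" "last r = hd q" "set r \<subseteq> set c"
    "length c + 2 \<le> 2 * length r"
    using vcycle_half[OF c p(1) q(1) ends(1)] .
  obtain s where s: "vpath s G" "hd s = last q" "last s = last p" "set s \<subseteq> set d"
    "length d + 2 \<le> 2 * length s"
    using vcycle_half[OF d q(2) p(2) ends(2)] .
  have ne'': "r \<noteq> []" "s \<noteq> []" using r s by (auto simp: vpath_iff)
  \<comment> \<open>\<open>x\<close> runs along \<open>c\<close>, then \<open>q\<close>, then \<open>d\<close>; the interior \<open>m\<close> of \<open>p\<close>, reversed, closes the cycle.\<close>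
  define x where "x = r @ butlast (tl q) @ s"
  have x: "vpath x G" unfolding x_def
    by (rule vpath_join) (use r s pq q disj in auto)
  define m where "m = butlast (tl p)"
  have "hd p \<noteq> last p" using p disj by auto
  then have p_eq: "p = [hd p] @ m @ [last p]"
    unfolding m_def using ne' by (cases p; cases "tl p" rule: rev_cases) auto
  have "vpath ([hd p] @ m @ [last p]) G" using pq(1) p_eq by simp
  then have "m = [] \<and> hd p \<rightarrow>\<^bsub>G\<^esub> last p \<or>
      m \<noteq> [] \<and> vpath m G \<and> hd p \<rightarrow>\<^bsub>G\<^esub> hd m \<and> last m \<rightarrow>\<^bsub>G\<^esub> last p"
    using vpath_append_iff[of "[hd p]" "m @ [last p]"] vpath_append_iff[of m "[last p]"]
    by (cases "m = []") auto
  moreover have "set m \<inter> set x = {}"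
  proof -
    have "tl p = m @ [last p]" "butlast p = hd p # m"
      by (metis p_eq append_Cons append_Nil list.sel(3))
         (metis p_eq append_assoc append_Cons append_Nil butlast_snoc)
    then have "set m \<subseteq> set (tl p)" "set m \<subseteq> set (butlast p)" "set m \<subseteq> set p"
      by (auto dest: in_set_butlastD) (metis in_set_butlastD list.set_intros(2))
    moreover have "set (butlast (tl q)) \<subseteq> set q"
      using ne'(2) by (meson in_set_butlastD list.set_sel(2) subsetI)
    ultimately show ?thesis using p q r s pq(3) unfolding x_def by auto
  qed
  ultimately have "vpath (x @ rev m) G" "last (x @ rev m) \<rightarrow>\<^bsub>G\<^esub> hd (x @ rev m)"
    using x r s ne'' vpath_rev[of m] vpath_append_iff[of x "rev m"]
    by (auto simp: x_def last_rev hd_rev adj_sym)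
  moreover have "length c < length (x @ rev m)" using r(5) s(5) len by (simp add: x_def)
  ultimately have "vcycle (x @ rev m) G"
    using \<open>length c \<ge> 3\<close> by (simp add: vcycle_def)
  with \<open>length c < length (x @ rev m)\<close> assms(2) show False
    by (auto simp: longest_cycle_def not_less[symmetric])
qed

end


section \<open>Longest paths and cycles are saturated\<close>

text \<open>
  A common property of longest paths and longest cycles. A cycle enters as the list of its vertices:
  an insertion between two neighbours in the list keeps the first and the last vertex, hence the
  closing edge, and so makes a longer cycle.
\<close>

definition saturated :: "('a, 'b) pre_digraph \<Rightarrow> 'a list \<Rightarrow> bool" where
  "saturated G p \<longleftrightarrow> vpath p G \<and> length p \<ge> 2 \<and>
     (\<forall>v\<in>verts G - set p. \<forall>i. Suc i < length p \<longrightarrow> \<not> (p ! i \<rightarrow>\<^bsub>G\<^esub> v \<and> v \<rightarrow>\<^bsub>G\<^esub> p ! Suc i))"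

lemma mem_consecutive:
  assumes "x \<in> set p" "length p \<ge> 2"
  obtains i where "Suc i < length p" "x = p ! i \<or> x = p ! Suc i"
proof -
  obtain i where i: "i < length p" "x = p ! i" using assms(1) by (metis in_set_conv_nth)
  show ?thesis
    by (cases i) (use i assms(2) that[of 0] that[of "i - 1"] in auto)
qed

context graph
begin

lemma longest_path_saturated:
  assumes p: "longest_path G p" and len: "length p \<ge> 2"
  shows "saturated G p"
  unfolding saturated_def
proof (intro conjI ballI allI impI notI)
  show vp: "vpath p G" using p by (simp add: longest_path_def)
  fix v i assume "v \<in> verts G - set p" "Suc i < length p" "p ! i \<rightarrow>\<^bsub>G\<^esub> v \<and> v \<rightarrow>\<^bsub>G\<^esub> p ! Suc i"
  then have "vpath (take (Suc i) p @ v # drop (Suc i) p) G" using vpath_insert[OF vp] by blast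
  then have "length (take (Suc i) p @ v # drop (Suc i) p) \<le> length p"
    using p unfolding longest_path_def by blast
  with \<open>Suc i < length p\<close> show False by simp
qed (rule len)

lemma longest_cycle_saturated:
  assumes c: "longest_cycle G c"
  shows "saturated G c"
  unfolding saturated_def
proof (intro conjI ballI allI impI notI)
  have vc: "length c \<ge> 3" "last c \<rightarrow>\<^bsub>G\<^esub> hd c" using c by (simp_all add: longest_cycle_def vcycle_def)
  then show "length c \<ge> 2" by simp
  show vp: "vpath c G" using c by (simp add: longest_cycle_def vcycle_def)
  fix v i assume v: "v \<in> verts G - set c" "Suc i < length c" "c ! i \<rightarrow>\<^bsub>G\<^esub> v \<and> v \<rightarrow>\<^bsub>G\<^esub> c ! Suc i"
  let ?d = "take (Suc i) c @ v # drop (Suc i) c"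
  have "vpath ?d G" using vpath_insert[OF vp] v by blast
  moreover have "hd ?d = hd c" using v(2) by (cases c) auto
  moreover have "last ?d = last c" using v(2) by simp
  moreover have "length ?d = Suc (length c)" using v(2) by simp
  ultimately have "vcycle ?d G" using vc by (simp add: vcycle_def)
  then have "length ?d \<le> length c" using c unfolding longest_cycle_def by blast
  with \<open>length ?d = Suc (length c)\<close> show False by simp
qed

end


section \<open>Angles on the circle\<close>

lemma cis_eq_cis_iff: "cis x = cis y \<longleftrightarrow> (\<exists>n::int. x = y + 2 * pi * of_int n)"
proof
  assume "cis x = cis y"
  then have "cos (x - y) = 1"
    using cis_divide[of x y] by (metis cis.simps(1) cis_neq_zero divide_self one_complex.simps(1))
  then obtain n :: int where "x - y = of_int n * 2 * pi"
    using cos_one_2pi_int by blast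
  then show "\<exists>n::int. x = y + 2 * pi * of_int n"
    by (intro exI[of _ n]) (simp add: algebra_simps)
next
  assume "\<exists>n::int. x = y + 2 * pi * of_int n"
  then show "cis x = cis y"
    by (auto simp flip: cis_mult)
qed

lemma cis_image_shift: "cis ` {a + 2 * pi * of_int n<..<b + 2 * pi * of_int n} = cis ` {a<..<b}"
proof -
  have "{a + 2 * pi * of_int n<..<b + 2 * pi * of_int n} = (\<lambda>t. t + 2 * pi * of_int n) ` {a<..<b}"
    by (auto simp: image_iff)
      (metis add_diff_cancel_right' diff_add_cancel diff_strict_right_mono greaterThanLessThan_iff)
  moreover have "cis (t + 2 * pi * of_int n) = cis t" for t
    using cis_eq_cis_iff by blast
  ultimately show ?thesis
    by (simp add: image_image)
qed

text \<open>
  The left endpoints are taken in the half-open interval that begins at \<open>s\<close>, so that an arc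
  beginning at \<open>cis s\<close>, where the circle is cut, has the smallest of them.
\<close>

lemma open_arc_lift:
  assumes "open_arc A"
  obtains a b where "s \<le> a" "a < s + 2 * pi" "a < b" "b \<le> a + 2 * pi" "A = cis ` {a<..<b}"
proof -
  obtain a b where ab: "a < b" "b \<le> a + 2 * pi" "A = cis ` {a<..<b}"
    using assms unfolding open_arc_def by blast
  define n where "n = - \<lfloor>(a - s) / (2 * pi)\<rfloor>"
  have "s \<le> a + 2 * pi * of_int n" "a + 2 * pi * of_int n < s + 2 * pi"
    using floor_divide_lower[of "2 * pi" "a - s"] floor_divide_upper[of "2 * pi" "a - s"]
    by (simp_all add: n_def algebra_simps)
  with ab that[of "a + 2 * pi * of_int n" "b + 2 * pi * of_int n"] show ?thesis
    by (simp add: cis_image_shift)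
qed

text \<open>
  Points, unlike left endpoints, have their angle in \<open>{s<..s + 2 * pi}\<close>: thus the point \<open>cis s\<close>, just
  before an arc that begins there, counts as the end of the circle. An arc whose lift ends after
  \<open>s + 2 * pi\<close> wraps around, which is the second alternative; there \<open>a < t + 2 * pi\<close> is automatic.
\<close>

lemma cis_mem_arc_iff:
  assumes "s \<le> a" "a < s + 2 * pi" "b \<le> a + 2 * pi" "s < t" "t \<le> s + 2 * pi"
  shows "cis t \<in> cis ` {a<..<b} \<longleftrightarrow> a < t \<and> t < b \<or> t + 2 * pi < b"
proof
  assume "cis t \<in> cis ` {a<..<b}"
  then obtain x n where x: "a < x" "x < b" "x = t + 2 * pi * of_int n"
    using cis_eq_cis_iff by (metis greaterThanLessThan_iff imageE)
  have "2 * pi * (- 1) < 2 * pi * of_int n" "2 * pi * of_int n < 2 * pi * 2"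
    using x assms by linarith+
  then have "- 1 < real_of_int n" "real_of_int n < 2"
    by (simp_all only: mult_less_cancel_left_pos[of "2 * pi"] pi_gt_zero mult_pos_pos zero_less_numeral)
  then have "n = 0 \<or> n = 1" by linarith
  with x show "a < t \<and> t < b \<or> t + 2 * pi < b" by auto
next
  assume "a < t \<and> t < b \<or> t + 2 * pi < b"
  moreover have "cis (t + 2 * pi) = cis t"
    using cis_eq_cis_iff[of "t + 2 * pi" t] by (metis mult.right_neutral of_int_1)
  moreover have "a < t + 2 * pi" using assms by linarith
  ultimately show "cis t \<in> cis ` {a<..<b}"
    by (metis greaterThanLessThan_iff image_eqI)
qed

lemma cis_surj_arc:
  assumes "z \<in> cis ` {a<..<b}"
  obtains t where "s < t" "t \<le> s + 2 * pi" "z = cis t"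
proof -
  obtain x where x: "z = cis x" using assms by blast
  define n where "n = 1 - \<lceil>(x - s) / (2 * pi)\<rceil>"
  have "s < x + 2 * pi * of_int n" "x + 2 * pi * of_int n \<le> s + 2 * pi"
    using ceiling_divide_lower[of "2 * pi" "x - s"] ceiling_divide_upper[of "2 * pi" "x - s"]
    by (simp_all add: n_def algebra_simps)
  moreover have "z = cis (x + 2 * pi * of_int n)"
    unfolding x by (metis cis_eq_cis_iff)
  ultimately show ?thesis by (rule that)
qed


section \<open>Saturated paths in a circular-arc graph\<close>

locale arc_model = graph G for G :: "('a, 'b) pre_digraph" +
  fixes F :: "'a \<Rightarrow> complex set"
  assumes open_arc: "v \<in> verts G \<Longrightarrow> open_arc (F v)"
    and adj_iff: "\<lbrakk>u \<in> verts G; v \<in> verts G; u \<noteq> v\<rbrakk> \<Longrightarrow> u \<rightarrow>\<^bsub>G\<^esub> v \<longleftrightarrow> F u \<inter> F v \<noteq> {}"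
begin

definition maximal_arc :: "'a \<Rightarrow> bool" where
  "maximal_arc v \<longleftrightarrow> v \<in> verts G \<and> (\<forall>w\<in>verts G. F v \<subseteq> F w \<longrightarrow> F w = F v)"

lemma ex_maximal_arc_above:
  assumes "v \<in> verts G"
  obtains w where "maximal_arc w" "F v \<subseteq> F w"
proof -
  have "finite (F ` verts G)" "F v \<in> F ` verts G" using assms by auto
  from finite_has_maximal2[OF this] show ?thesis
    using that unfolding maximal_arc_def by (metis imageE imageI)
qed

text \<open>The second part is the crucial property: a point in all three arcs would allow inserting \<open>v\<close>.\<close>

lemma saturated_overlap:
  assumes "saturated G p" "Suc i < length p"
  shows "F (p ! i) \<inter> F (p ! Suc i) \<noteq> {}"
    and "v \<in> verts G - set p \<Longrightarrow> F (p ! i) \<inter> F (p ! Suc i) \<inter> F v = {}"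
proof -
  have p: "distinct p" "set p \<subseteq> verts G" "p ! i \<rightarrow>\<^bsub>G\<^esub> p ! Suc i"
    using assms unfolding saturated_def vpath_iff successively_conv_nth by auto
  have "p ! i \<noteq> p ! Suc i" "p ! i \<in> set p" "p ! Suc i \<in> set p"
    using p(1) assms(2) by (auto simp: nth_eq_iff_index_eq)
  with p show "F (p ! i) \<inter> F (p ! Suc i) \<noteq> {}"
    using adj_iff by blast
  assume v: "v \<in> verts G - set p"
  with assms have "\<not> (p ! i \<rightarrow>\<^bsub>G\<^esub> v \<and> v \<rightarrow>\<^bsub>G\<^esub> p ! Suc i)"
    unfolding saturated_def by blast
  with v \<open>p ! i \<in> set p\<close> \<open>p ! Suc i \<in> set p\<close> p(2)
  show "F (p ! i) \<inter> F (p ! Suc i) \<inter> F v = {}"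
    using adj_iff[of "p ! i" v] adj_iff[of v "p ! Suc i"] by blast
qed

text \<open>
  A vertex \<open>x\<close> of the list has a neighbour in it, and their overlap is nonempty and lies in \<open>F x\<close>, hence
  in \<open>F v\<close>.
\<close>

lemma saturated_upward_closed:
  assumes p: "saturated G p" and x: "x \<in> set p" and v: "v \<in> verts G" "F x \<subseteq> F v"
  shows "v \<in> set p"
proof (rule ccontr)
  assume nv: "v \<notin> set p"
  obtain j where j: "Suc j < length p" "x = p ! j \<or> x = p ! Suc j"
    using mem_consecutive x p unfolding saturated_def by metis
  then show False
    using saturated_overlap[OF p j(1)] j(2) v nv by blast
qed

text \<open>
  With the circle cut at \<open>s\<close>, the complement of \<open>F k \<union> F h\<close> has its angles in \<open>{e..a}\<close> or in
  \<open>{b..s + 2 * pi}\<close>, and either interval may be empty. An arc through points of both passes over \<open>h\<close> or,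
  around the other way, over \<open>k\<close>.
\<close>

lemma saturated_one_side:
  assumes p: "saturated G p"
    and k: "maximal_arc k" "k \<notin> set p" "F k = cis ` {s<..<e}" "s < e" "e \<le> s + 2 * pi"
    and h: "maximal_arc h" "h \<notin> set p" "F h = cis ` {a<..<b}"
      "s \<le> a" "a < s + 2 * pi" "a < b" "b \<le> a + 2 * pi"
  shows "(\<forall>x\<in>set p. \<exists>t. e \<le> t \<and> t \<le> a \<and> cis t \<in> F x) \<or>
    (\<forall>x\<in>set p. \<exists>t. b \<le> t \<and> t \<le> s + 2 * pi \<and> cis t \<in> F x)"
proof -
  have verts: "set p \<subseteq> verts G" "k \<in> verts G" "h \<in> verts G"
    using p k h unfolding saturated_def vpath_iff maximal_arc_def by auto
  have not_above: "\<not> F v \<subseteq> F x" if "x \<in> set p" "maximal_arc v" "v \<notin> set p" for x v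
    using saturated_upward_closed[OF p that(1), of v] that verts unfolding maximal_arc_def by blast
  have no_crossing: False
    if x: "x \<in> set p" and t: "e \<le> t" "t \<le> a" "cis t \<in> F x" and u: "b \<le> u" "u \<le> s + 2 * pi" "cis u \<in> F x"
    for x t u
  proof -
    obtain c d where cd: "s \<le> c" "c < s + 2 * pi" "c < d" "d \<le> c + 2 * pi" "F x = cis ` {c<..<d}"
      using open_arc_lift open_arc x verts(1) by (metis subsetD)
    have "c < t \<and> t < d \<or> t + 2 * pi < d" "c < u \<and> u < d \<or> u + 2 * pi < d"
      using t(3) u(3) cis_mem_arc_iff[OF cd(1,2,4)] t(1,2) u(1,2) h k unfolding cd(5) by auto
    then consider "c < t" "u < d" | "t + 2 * pi < d"
      using t u h(6) by fastforce
    then show False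
    proof cases
      case 1
      then have "{a<..<b} \<subseteq> {c<..<d}" using t u by auto
      then show False using not_above[OF x h(1,2)] unfolding h(3) cd(5) by blast
    next
      case 2
      have "F k = cis ` {s + 2 * pi<..<e + 2 * pi}"
        using cis_image_shift[of s 1 e] k(3) by simp
      moreover have "{s + 2 * pi<..<e + 2 * pi} \<subseteq> {c<..<d}" using 2 t cd by auto
      ultimately show False using not_above[OF x k(1,2)] unfolding cd(5) by blast
    qed
  qed
  \<comment> \<open>Consecutive overlaps lie in a common arc, so by \<open>no_crossing\<close> the side cannot change.\<close>
  define L where "L i \<longleftrightarrow> (\<exists>t. e \<le> t \<and> t \<le> a \<and> cis t \<in> F (p ! i) \<inter> F (p ! Suc i))" for i
  define R where "R i \<longleftrightarrow> (\<exists>t. b \<le> t \<and> t \<le> s + 2 * pi \<and> cis t \<in> F (p ! i) \<inter> F (p ! Suc i))" for i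
  have LR: "L i \<or> R i" if i: "Suc i < length p" for i
  proof -
    obtain z where z: "z \<in> F (p ! i) \<inter> F (p ! Suc i)"
      using saturated_overlap(1)[OF p i] by blast
    have "p ! i \<in> verts G" using i verts by auto
    then obtain t where t: "s < t" "t \<le> s + 2 * pi" "z = cis t"
      using z cis_surj_arc open_arc unfolding open_arc_def by (metis IntD1)
    have "cis t \<notin> F k" "cis t \<notin> F h"
      using saturated_overlap(2)[OF p i] z t(3) k h verts by blast+
    then have "\<not> (s < t \<and> t < e)" "\<not> (a < t \<and> t < b)"
      unfolding k(3) h(3) by auto
    with z t show ?thesis unfolding L_def R_def by force
  qed
  have not_both: "\<not> (L i \<and> R j)" if "p ! i' \<in> set p" "i' = i \<or> i' = Suc i" "i' = j \<or> i' = Suc j" for i j i'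
    using that no_crossing unfolding L_def R_def by blast
  have len: "length p \<ge> 2" using p by (simp add: saturated_def)
  have adj: "L i \<longleftrightarrow> L (Suc i)" "R i \<longleftrightarrow> R (Suc i)" if "Suc (Suc i) < length p" for i
    using LR[of i] LR[of "Suc i"] not_both[of "Suc i" i "Suc i"] not_both[of "Suc i" "Suc i" i]
      not_both[of "Suc i" i i] not_both[of "Suc i" "Suc i" "Suc i"] that by auto
  have all: "L i = L 0 \<and> R i = R 0" if "Suc i < length p" for i
    using that by (induction i) (use adj in auto)
  have link: "\<exists>j. Suc j < length p \<and> (x = p ! j \<or> x = p ! Suc j)" if "x \<in> set p" for x
    using mem_consecutive[OF that len] by metis
  have "L 0 \<or> R 0" using LR len by auto
  then show ?thesis
  proof
    assume "L 0"
    then show ?thesis using link all unfolding L_def by blast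
  next
    assume "R 0"
    then show ?thesis using link all unfolding R_def by blast
  qed
qed

text \<open>
  Cut the circle at an arbitrary maximal arc \<open>k\<close>, and let \<open>p\<close>, among the lists that miss \<open>k\<close>, be one
  whose last maximal arc \<open>h\<close> comes first. A list \<open>q\<close> that misses \<open>k\<close> and \<open>h\<close> shares with \<open>p\<close> a maximal arc
  \<open>x\<close>, which comes before \<open>h\<close>, and by the choice of \<open>p\<close> it has a maximal arc \<open>y\<close> after \<open>h\<close>; so \<open>q\<close> would
  be on both sides of \<open>h\<close>.
\<close>

theorem saturated_transversal:
  assumes sat: "\<And>p. p \<in> P \<Longrightarrow> saturated G p"
    and meet: "\<And>p q. \<lbrakk>p \<in> P; q \<in> P\<rbrakk> \<Longrightarrow> set p \<inter> set q \<noteq> {}"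
  obtains T where "T \<subseteq> verts G" "card T \<le> 2" "\<And>p. p \<in> P \<Longrightarrow> T \<inter> set p \<noteq> {}"
proof (cases "P = {}")
  case True
  then show ?thesis using that[of "{}"] by auto
next
  case False
  then obtain p0 where p0: "p0 \<in> P" by blast
  have vp: "set p \<subseteq> verts G" if "p \<in> P" for p
    using sat[OF that] unfolding saturated_def vpath_iff by blast
  obtain v0 where "v0 \<in> verts G" using meet[OF p0 p0] vp[OF p0] by blast
  then obtain k where k: "maximal_arc k" by (rule ex_maximal_arc_above)
  then have kv: "k \<in> verts G" by (simp add: maximal_arc_def)
  obtain s e where se: "s < e" "e \<le> s + 2 * pi" "F k = cis ` {s<..<e}"
    using open_arc[OF kv] unfolding open_arc_def by blast
  have "\<exists>a b. s \<le> a \<and> a < s + 2 * pi \<and> a < b \<and> b \<le> a + 2 * pi \<and> F v = cis ` {a<..<b}"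
    if "v \<in> verts G" for v
    using open_arc_lift[OF open_arc[OF that], of s] by metis
  then obtain a b where ab: "\<And>v. v \<in> verts G \<Longrightarrow> s \<le> a v \<and> a v < s + 2 * pi \<and> a v < b v \<and>
      b v \<le> a v + 2 * pi \<and> F v = cis ` {a v<..<b v}"
    by metis
  have nested: "F u \<subseteq> F v" if "u \<in> verts G" "v \<in> verts G" "a v \<le> a u" "b u \<le> b v" for u v
  proof -
    have "{a u<..<b u} \<subseteq> {a v<..<b v}" using that by auto
    then show ?thesis using ab[OF that(1)] ab[OF that(2)] by blast
  qed
  define A where "A p = a ` {x \<in> set p. maximal_arc x}" for p
  have fin: "finite (A p)" for p by (simp add: A_def)
  have ne: "A p \<noteq> {}" if p: "p \<in> P" for p
  proof -
    obtain x where x: "x \<in> set p" using meet[OF p p] by blast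
    then obtain y where "maximal_arc y" "F x \<subseteq> F y" using ex_maximal_arc_above vp[OF p] by blast
    then have "y \<in> set p"
      using saturated_upward_closed[OF sat[OF p] x] by (simp add: maximal_arc_def)
    with \<open>maximal_arc y\<close> show ?thesis by (auto simp: A_def)
  qed
  define Pk where "Pk = {p \<in> P. k \<notin> set p}"
  show ?thesis
  proof (cases "Pk = {}")
    case True
    show ?thesis by (rule that[of "{k}"]) (use kv True in \<open>auto simp: Pk_def\<close>)
  next
    case False
    have "finite ((\<lambda>p. Max (A p)) ` Pk)"
    proof (rule finite_subset)
      show "(\<lambda>p. Max (A p)) ` Pk \<subseteq> a ` verts G"
        using Max_in[OF fin ne] vp unfolding A_def Pk_def by fastforce
    qed simp
    then have "Min ((\<lambda>p. Max (A p)) ` Pk) \<in> (\<lambda>p. Max (A p)) ` Pk"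
      using False by (intro Min_in) auto
    then obtain p where p: "p \<in> Pk" "Max (A p) = Min ((\<lambda>p. Max (A p)) ` Pk)" by fastforce
    then have pmin: "Max (A p) \<le> Max (A q)" if "q \<in> Pk" for q
      using that \<open>finite ((\<lambda>p. Max (A p)) ` Pk)\<close> by auto
    have "Max (A p) \<in> A p" using p ne fin unfolding Pk_def by (intro Max_in) auto
    then obtain h where h: "h \<in> set p" "maximal_arc h" "a h = Max (A p)" by (auto simp: A_def)
    have hv: "h \<in> verts G" using h by (simp add: maximal_arc_def)
    have "h \<in> set q" if q: "q \<in> Pk" for q
    proof (rule ccontr)
      assume hq: "h \<notin> set q"
      have qP: "q \<in> P" "k \<notin> set q" "p \<in> P" using q p by (auto simp: Pk_def)
      note sq = sat[OF qP(1)] and sp = sat[OF qP(3)]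
      have eq: "v \<in> set q" if "u \<in> set q" "maximal_arc v" "maximal_arc u" "F v \<subseteq> F u \<or> F u \<subseteq> F v" for u v
      proof -
        have "F u = F v" "v \<in> verts G" using that(2-4) unfolding maximal_arc_def by auto
        then show ?thesis using saturated_upward_closed[OF sq that(1), of v] by simp
      qed
      obtain z where z: "z \<in> set p" "z \<in> set q" using meet[OF qP(3,1)] by blast
      then obtain x where x: "maximal_arc x" "F z \<subseteq> F x" using ex_maximal_arc_above vp qP by blast
      then have xv: "x \<in> verts G" by (simp add: maximal_arc_def)
      have xpq: "x \<in> set p" "x \<in> set q"
        using saturated_upward_closed[OF sp z(1) xv x(2)] saturated_upward_closed[OF sq z(2) xv x(2)] .
      have "a x \<le> a h" using xpq x fin unfolding h(3) by (intro Max_ge) (auto simp: A_def)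
      \<comment> \<open>Maximal arcs that are not nested have their right endpoints in the order of the left ones.\<close>
      have bx: "b x < b h"
        using nested[OF hv xv \<open>a x \<le> a h\<close>] eq[OF xpq(2) h(2) x(1)] hq by linarith
      have "Max (A q) \<in> A q" using ne fin qP by (intro Max_in) auto
      then obtain y where y: "y \<in> set q" "maximal_arc y" "a y = Max (A q)" by (auto simp: A_def)
      then have yv: "y \<in> verts G" by (simp add: maximal_arc_def)
      have "a h \<le> a y" using pmin[OF q] h y by simp
      have "(\<forall>x\<in>set q. \<exists>t. e \<le> t \<and> t \<le> a h \<and> cis t \<in> F x) \<or>
        (\<forall>x\<in>set q. \<exists>t. b h \<le> t \<and> t \<le> s + 2 * pi \<and> cis t \<in> F x)"
        using ab[OF hv] by (intro saturated_one_side[OF sq k qP(2) se(3,1,2) h(2) hq]) auto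
      then show False
      proof
        assume "\<forall>x\<in>set q. \<exists>t. e \<le> t \<and> t \<le> a h \<and> cis t \<in> F x"
        then obtain t where t: "e \<le> t" "t \<le> a h" "cis t \<in> F y" using y by blast
        have "a y < t \<and> t < b y \<or> t + 2 * pi < b y"
          using t(3) ab[OF yv] ab[OF hv] cis_mem_arc_iff[of s "a y" "b y" t] t(1,2) se by auto
        \<comment> \<open>Reaching an angle up to \<open>a h\<close>, the arc of \<open>y\<close> would have to wrap around and pass over \<open>k\<close>.\<close>
        then have "t + 2 * pi < b y" using \<open>a h \<le> a y\<close> t by linarith
        then have "{s + 2 * pi<..<e + 2 * pi} \<subseteq> {a y<..<b y}"
          using ab[OF yv] t by auto
        from image_mono[OF this, of cis] have "F k \<subseteq> F y"
          using ab[OF yv] cis_image_shift[of s 1 e] se(3) by simp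
        then show False using eq[OF y(1) k y(2)] qP by blast
      next
        assume "\<forall>x\<in>set q. \<exists>t. b h \<le> t \<and> t \<le> s + 2 * pi \<and> cis t \<in> F x"
        then obtain t where t: "b h \<le> t" "t \<le> s + 2 * pi" "cis t \<in> F x" using xpq by blast
        have "a x < t \<and> t < b x \<or> t + 2 * pi < b x"
          using t(3) ab[OF xv] ab[OF hv] cis_mem_arc_iff[of s "a x" "b x" t] t(1,2) by auto
        then show False using t bx pi_gt_zero by linarith
      qed
    qed
    moreover have "card {k, h} \<le> 2" by (cases "k = h") auto
    ultimately show ?thesis
      using that[of "{k, h}"] kv hv unfolding Pk_def by auto
  qed
qed

end

section \<open>Transversals of longest paths and longest cycles\<close>

lemma lpt_le: "longest_path_transversal G T \<Longrightarrow> lpt G \<le> card T"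
  unfolding lpt_def by (rule Least_le) blast

lemma lct_le: "longest_cycle_transversal G T \<Longrightarrow> lct G \<le> card T"
  unfolding lct_def by (rule Least_le) blast

context arc_model
begin

text \<open>
  A path of order 1 has no consecutive vertices and is not saturated; the only connected graph in
  which it is longest has one vertex, so the case of at most two vertices is split off.
\<close>

lemma lpt_le_2:
  assumes con: "Digraph_Component.connected G"
  shows "lpt G \<le> 2"
proof (cases "card (verts G) \<le> 2")
  case True
  then show ?thesis
    using lpt_le[OF longest_path_transversal_verts] le_trans by blast
next
  case False
  then obtain u v where uv: "u \<in> verts G" "v \<in> verts G" "u \<noteq> v"
    using card_le_Suc0_iff_eq[OF finite_verts] by (metis One_nat_def Suc_1 le_SucI)
  then obtain r where r: "vpath r G" "hd r = u" "last r = v" using connected_vpath[OF con] by blast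
  then have r2: "length r \<ge> 2" using uv(3) by (cases r; cases "tl r") (auto simp: vpath_iff)
  have sat: "saturated G p" if "longest_path G p" for p
  proof -
    have "length r \<le> length p" using that r(1) by (simp add: longest_path_def)
    with r2 longest_path_saturated[OF that] show ?thesis by simp
  qed
  obtain T where T: "T \<subseteq> verts G" "card T \<le> 2" "\<And>p. longest_path G p \<Longrightarrow> T \<inter> set p \<noteq> {}"
    using saturated_transversal[of "Collect (longest_path G)"] sat longest_paths_meet[OF con] by auto
  then have "longest_path_transversal G T" by (simp add: longest_path_transversal_def)
  then show ?thesis using lpt_le T(2) le_trans by blast
qed

lemma lct_le_2:
  assumes con: "two_connected G"
  shows "lct G \<le> 2"
proof -
  obtain T where T: "T \<subseteq> verts G" "card T \<le> 2" "\<And>c. longest_cycle G c \<Longrightarrow> T \<inter> set c \<noteq> {}"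
    using saturated_transversal[of "Collect (longest_cycle G)"] longest_cycle_saturated
      longest_cycles_meet[OF con] by auto
  then have "longest_cycle_transversal G T" by (simp add: longest_cycle_transversal_def)
  then show ?thesis using lct_le T(2) le_trans by blast
qed

end

theorem theorem7:
  fixes G :: "('a, 'b) pre_digraph"
  assumes "circular_arc_graph G"
  shows "(Digraph_Component.connected G \<longrightarrow> lpt G \<le> 3) \<and> (two_connected G \<longrightarrow> lct G \<le> 3)"
proof -
  obtain F where "graph G" "\<forall>v\<in>verts G. open_arc (F v)"
    "\<forall>u\<in>verts G. \<forall>v\<in>verts G. u \<noteq> v \<longrightarrow> (u \<rightarrow>\<^bsub>G\<^esub> v \<longleftrightarrow> F u \<inter> F v \<noteq> {})"
    using assms unfolding circular_arc_graph_def by blast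
  then interpret arc_model G F
    by (intro arc_model.intro arc_model_axioms.intro) auto
  show ?thesis using lpt_le_2 lct_le_2 by fastforce
qed

end
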